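(* If a virtual link diagram $D$ is obtained from an almost classical virtual link diagram by replacing a classical crossing with a virtual crossing, then its multivariable polynomial satisfies $$X_D\in\mathbb{Z}[A^{\pm1},d_1].$$
   Context: **Virtual link diagrams.** A virtual link diagram is a (nonempty, finite) collection of immersed oriented loops in $\mathbb{R}^2$ whose multiple points are transverse double points, each being either a classical crossing (with over/under information, and hence positive or negative in the usual sense) or a virtual crossing (no over/under information). The writhe $w(D)$ is the number of positive crossings minus the number of negative crossings of $D$. **Alexander numberings.** A semi-arc of $D$ is an immersed arc in a component of $D$ between two (consecutive) classical crossings, or an immersed loop of $D$ missing classical crossings; semi-arcs pass through virtual crossings. An Alexander numbering of $D$ is an assignment of an integer to each semi-arc such that at each classical crossing, drawn with both strands oriented upward, there is some $i\in\mathbb{Z}$ such that the two left semi-arcs (bottom-left and top-left) are numbered $i$ and the two right semi-arcs (bottom-right and top-right) are numbered $i+1$, regardless of the sign of the crossing. $D$ is almost classical if it admits an Alexander numbering. **Cut systems.** An oriented cut point is a point on a semi-arc of $D$ (away from crossings) together with a choice of one of the two directions along the semi-arc (which need not agree with the orientation of $D$). A cut system of $D$ is a finite set $C$ of oriented cut points such that $D$ with $C$ admits an Alexander numbering, i.e. integers can be assigned to the pieces of semi-arcs cut at the cut points so that at each classical crossing, drawn with both strands oriented upward, there is some $i\in\mathbb{Z}$ such that the two left pieces (bottom-left and top-left) are numbered $i$ and the two right pieces (bottom-right and top-right) are numbered $i+1$ (regardless of the sign of the crossing), numbers are unchanged through virtual crossings, and the number increases by $1$ when one passes a cut point in the direction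 of that cut point. Every virtual link diagram has a cut system; the empty set is a cut system of an almost classical diagram. **States and indices.** At a positive crossing the A-splice is the orientation-respecting smoothing and the B-splice is the other smoothing; at a negative crossing the B-splice is the orientation-respecting smoothing and the A-splice is the other one. A state $\sigma$ of $(D,C)$ is the union of immersed loops in $\mathbb{R}^2$, with virtual crossings and oriented cut points, obtained by choosing an A- or B-splice at every classical crossing of $D$. For a loop $\ell$ of a state, its index $\iota(\ell)\ge 0$ is determined by: virtual crossings are ignored; two adjacent cut points of $\ell$ with opposite directions along $\ell$ may be cancelled; a loop with $2r$ cut points all in the same direction along the loop has index $r$. Equivalently, $\iota(\ell)$ is half the absolute value of the number of cut points of $\ell$ pointing in one direction along $\ell$ minus the number pointing in the other direction (this difference is always even). Let $\natural\sigma$ be the number of A-splices minus the number of B-splices used to obtain $\sigma$, $\sharp\sigma$ the number of loops of $\sigma$, and $\tau_i(\sigma)$ the number of loops of $\sigma$ of index $i$. **The polynomial.** The double bracket is $$\langle\!\langle D,C\rangle\!\rangle=\sum_{\sigma}A^{\natural\sigma}(-A^2-A^{-2})^{\sharp\sigma-1}d_1^{\tau_1(\sigma)}d_2^{\tau_2(\sigma)}\cdots\in\mathbb{Z}[A^{\pm1},d_1,d_2,\dots],$$ the sum running over all states $\sigma$ of $(D,C)$. It is known (N. Kamada) not to depend on the choice of the cut system $C$, so write $\langle\!\langle D\rangle\!\rangle$. The multivariable polynomial of $D$ is $X_D=(-A^3)^{-w(D)}\langle\!\langle D\rangle\!\rangle$; it is an invariant of virtual links. *)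

theory Defs
  imports
    "HOL-Analysis.Analysis"
    "HOL-Combinatorics.Orbits"
    "HOL-Library.Poly_Mapping"
    "HOL-Library.Product_Plus"
begin

section \<open>Virtual link diagrams\<close>

text \<open>
  The plane is \<open>complex\<close>. A loop is a 1-periodic curve on \<open>real\<close>, so a point of
  the domain of the diagram is a pair \<open>(k, t)\<close> of a component \<open>k\<close> and a parameter
  \<open>t \<in> {0..<1}\<close>. The pairs over a crossing are called its passages.
\<close>

type_synonym passage = "nat \<times> real"

datatype crossing_type = Virtual | Classical (over_passage: passage)

record vlink =
  ncomp :: nat
  curve :: "nat \<Rightarrow> real \<Rightarrow> complex"
  ctype :: "complex \<Rightarrow> crossing_type"  \<comment> \<open>only its values at crossings matter\<close>

definition points :: "vlink \<Rightarrow> passage set" where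
  "points D = {..<ncomp D} \<times> {0..<1}"

definition location :: "vlink \<Rightarrow> passage \<Rightarrow> complex" where
  "location D p = curve D (fst p) (snd p)"

definition velocity :: "vlink \<Rightarrow> passage \<Rightarrow> complex" where
  "velocity D p = vector_derivative (curve D (fst p)) (at (snd p))"

definition passages :: "vlink \<Rightarrow> complex \<Rightarrow> passage set" where
  "passages D z = {p \<in> points D. location D p = z}"

definition crossings :: "vlink \<Rightarrow> complex set" where
  "crossings D = {z. \<exists>p \<in> passages D z. \<exists>q \<in> passages D z. p \<noteq> q}"

text \<open>\<open>plane_det v w > 0\<close> iff \<open>w\<close> points to the left of \<open>v\<close>.\<close>

definition plane_det :: "complex \<Rightarrow> complex \<Rightarrow> real" where
  "plane_det v w = Re v * Im w - Im v * Re w"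

definition vlink_diagram :: "vlink \<Rightarrow> bool" where
  "vlink_diagram D \<longleftrightarrow>
     0 < ncomp D \<and>
     (\<forall>k < ncomp D. curve D k C1_differentiable_on UNIV \<and>
        (\<forall>t. curve D k (t + 1) = curve D k t) \<and>
        (\<forall>t. vector_derivative (curve D k) (at t) \<noteq> 0)) \<and>
     finite (crossings D) \<and>
     (\<forall>z \<in> crossings D. card (passages D z) = 2 \<and>
        (\<forall>p \<in> passages D z. \<forall>q \<in> passages D z. p \<noteq> q \<longrightarrow>
           plane_det (velocity D p) (velocity D q) \<noteq> 0) \<and>
        (\<forall>p. ctype D z = Classical p \<longrightarrow> p \<in> passages D z))"

definition classical :: "vlink \<Rightarrow> complex set" where
  "classical D = {z \<in> crossings D. ctype D z \<noteq> Virtual}"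

text \<open>
  When a crossing is drawn with both strands oriented upward, \<open>rising_right\<close> is the
  strand from bottom left to top right and \<open>rising_left\<close> the one from bottom right
  to top left.
\<close>

definition rising_right :: "vlink \<Rightarrow> complex \<Rightarrow> passage" where
  "rising_right D z = (THE p. p \<in> passages D z \<and>
     (\<exists>q \<in> passages D z. plane_det (velocity D p) (velocity D q) > 0))"

definition rising_left :: "vlink \<Rightarrow> complex \<Rightarrow> passage" where
  "rising_left D z = (THE q. q \<in> passages D z \<and>
     (\<exists>p \<in> passages D z. plane_det (velocity D p) (velocity D q) > 0))"

definition positive :: "vlink \<Rightarrow> complex \<Rightarrow> bool" where
  "positive D z \<longleftrightarrow> ctype D z = Classical (rising_right D z)"

definition writhe :: "vlink \<Rightarrow> int" where
  "writhe D = int (card {z \<in> classical D. positive D z})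
            - int (card {z \<in> classical D. \<not> positive D z})"

definition make_virtual :: "vlink \<Rightarrow> complex \<Rightarrow> vlink" where
  "make_virtual D c = D\<lparr>ctype := (ctype D)(c := Virtual)\<rparr>"


section \<open>Semi-arcs and Alexander numberings\<close>

text \<open>
  Marks on the components cut them into arcs. \<open>Arc k t\<close> is the arc of component \<open>k\<close>
  from the mark \<open>t\<close> to the cyclically next mark of \<open>k\<close> (possibly \<open>t\<close> again);
  \<open>Loop k\<close> is a whole component without marks. With the passages of the classical
  crossings as marks the arcs are the semi-arcs of the diagram; with the cut points added
  they are the pieces of semi-arcs.
\<close>

datatype arc = Arc nat real | Loop nat

definition pred_mark :: "real set \<Rightarrow> real \<Rightarrow> real" where
  "pred_mark M t = (if \<exists>m \<in> M. m < t then Max {m \<in> M. m < t} else Max M)"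

definition succ_mark :: "real set \<Rightarrow> real \<Rightarrow> real" where
  "succ_mark M t = (if \<exists>m \<in> M. t < m then Min {m \<in> M. t < m} else Min M)"

text \<open>
  \<open>arc_before M p\<close> is the arc ending at \<open>p\<close> if \<open>p\<close> is a mark, and the arc containing
  \<open>p\<close> otherwise. \<open>arc_after\<close> is only used at marks.
\<close>

definition arc_before :: "(nat \<Rightarrow> real set) \<Rightarrow> passage \<Rightarrow> arc" where
  "arc_before M p = (if M (fst p) = {} then Loop (fst p)
                     else Arc (fst p) (pred_mark (M (fst p)) (snd p)))"

definition arc_after :: "passage \<Rightarrow> arc" where
  "arc_after p = Arc (fst p) (snd p)"

definition cmarks :: "vlink \<Rightarrow> nat \<Rightarrow> real set" where
  "cmarks D k = {t. (k, t) \<in> points D \<and> location D (k, t) \<in> classical D}"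

definition semi_arcs :: "vlink \<Rightarrow> arc set" where
  "semi_arcs D = {Arc k t |k t. k < ncomp D \<and> t \<in> cmarks D k}
               \<union> {Loop k |k. k < ncomp D \<and> cmarks D k = {}}"

text \<open>An oriented cut point; \<open>True\<close> means that its direction agrees with the diagram.\<close>

type_synonym cut_point = "passage \<times> bool"

definition cut_marks :: "vlink \<Rightarrow> cut_point set \<Rightarrow> nat \<Rightarrow> real set" where
  "cut_marks D C k = cmarks D k \<union> {t. (k, t) \<in> fst ` C}"

definition alexander_numbering :: "vlink \<Rightarrow> cut_point set \<Rightarrow> (arc \<Rightarrow> int) \<Rightarrow> bool" where
  "alexander_numbering D C f \<longleftrightarrow>
     (\<forall>z \<in> classical D. \<exists>i.
        f (arc_before (cut_marks D C) (rising_right D z)) = i \<and>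
        f (arc_after (rising_left D z)) = i \<and>
        f (arc_before (cut_marks D C) (rising_left D z)) = i + 1 \<and>
        f (arc_after (rising_right D z)) = i + 1) \<and>
     (\<forall>(p, forward) \<in> C.
        f (arc_after p) = f (arc_before (cut_marks D C) p) + (if forward then 1 else - 1))"

definition almost_classical :: "vlink \<Rightarrow> bool" where
  "almost_classical D \<longleftrightarrow> (\<exists>f. alexander_numbering D {} f)"

definition cut_system :: "vlink \<Rightarrow> cut_point set \<Rightarrow> bool" where
  "cut_system D C \<longleftrightarrow>
     finite C \<and> inj_on fst C \<and>
     (\<forall>p \<in> fst ` C. p \<in> points D \<and> location D p \<notin> crossings D) \<and>
     (\<exists>f. alexander_numbering D C f)"


section \<open>States and indices\<close>

text \<open>A state is given by the set of those classical crossings that are A-spliced.\<close>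

definition states :: "vlink \<Rightarrow> complex set set" where
  "states D = Pow (classical D)"

definition oriented_splice :: "vlink \<Rightarrow> complex set \<Rightarrow> complex \<Rightarrow> bool" where
  "oriented_splice D \<sigma> z \<longleftrightarrow> (z \<in> \<sigma> \<longleftrightarrow> positive D z)"

definition partner :: "vlink \<Rightarrow> passage \<Rightarrow> passage" where
  "partner D p = (THE q. q \<in> passages D (location D p) \<and> q \<noteq> p)"

text \<open>
  The loops of a state are traced through semi-arcs with a direction of travel, \<open>True\<close>
  being the orientation of \<open>D\<close>. At a crossing the orientation-respecting splice joins the
  incoming end of each strand to the outgoing end of the other one; the other splice
  joins the two incoming ends and the two outgoing ends.
\<close>

fun trace_step :: "vlink \<Rightarrow> complex set \<Rightarrow> arc \<times> bool \<Rightarrow> arc \<times> bool" where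
  "trace_step D \<sigma> (Loop k, forward) = (Loop k, forward)"
| "trace_step D \<sigma> (Arc k t, forward) =
     (let p = (k, if forward then succ_mark (cmarks D k) t else t);
          q = partner D p;
          forward' = (if oriented_splice D \<sigma> (location D p) then forward else \<not> forward)
      in (if forward' then arc_after q else arc_before (cmarks D) q, forward'))"

definition directed_loops :: "vlink \<Rightarrow> complex set \<Rightarrow> (arc \<times> bool) set set" where
  "directed_loops D \<sigma> = orbit (trace_step D \<sigma>) ` (semi_arcs D \<times> UNIV)"

definition cut_count :: "vlink \<Rightarrow> cut_point set \<Rightarrow> arc \<Rightarrow> int" where
  "cut_count D C a =
     (\<Sum>(p, forward) \<in> {c \<in> C. arc_before (cmarks D) (fst c) = a}. if forward then 1 else - 1)"

definition loop_index :: "vlink \<Rightarrow> cut_point set \<Rightarrow> (arc \<times> bool) set \<Rightarrow> nat" where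
  "loop_index D C L =
     nat \<bar>\<Sum>(a, forward) \<in> L. (if forward then 1 else - 1) * cut_count D C a\<bar> div 2"

text \<open>
  Every loop of a state occurs in \<open>directed_loops\<close> once for each of its two directions,
  with the same index; forgetting directions leaves its set of semi-arcs.
\<close>

definition num_loops :: "vlink \<Rightarrow> complex set \<Rightarrow> nat" where
  "num_loops D \<sigma> = card ((`) fst ` directed_loops D \<sigma>)"

definition num_loops_of_index :: "vlink \<Rightarrow> cut_point set \<Rightarrow> complex set \<Rightarrow> nat \<Rightarrow> nat" where
  "num_loops_of_index D C \<sigma> i =
     card ((`) fst ` {L \<in> directed_loops D \<sigma>. loop_index D C L = i})"

definition splice_difference :: "vlink \<Rightarrow> complex set \<Rightarrow> int" where
  "splice_difference D \<sigma> = int (card \<sigma>) - int (card (classical D - \<sigma>))"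


section \<open>The multivariable polynomial\<close>

text \<open>
  \<open>\<int>[A\<^sup>\<plusminus>\<^sup>1, d\<^sub>1, d\<^sub>2, \<dots>]\<close> as a monoid algebra: \<open>(k, m)\<close> is the exponent of the monomial
  \<open>A\<^sup>k \<Prod>\<^sub>i d\<^sub>i\<^bsup>m i\<^esup>\<close>. The variable number 0 is never used.
\<close>

type_synonym poly_Ad = "(int \<times> (nat \<Rightarrow>\<^sub>0 nat)) \<Rightarrow>\<^sub>0 int"

definition A_pow :: "int \<Rightarrow> poly_Ad" where
  "A_pow k = Poly_Mapping.single (k, 0) 1"

definition d_var :: "nat \<Rightarrow> poly_Ad" where
  "d_var i = Poly_Mapping.single (0, Poly_Mapping.single i 1) 1"

text \<open>\<open>(- A\<^sup>3)\<^bsup>k\<^esup>\<close> for an integer \<open>k\<close>; note that \<open>- A_pow (- 3)\<close> is inverse to \<open>- A_pow 3\<close>.\<close>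

definition minus_A3_pow :: "int \<Rightarrow> poly_Ad" where
  "minus_A3_pow k = (if 0 \<le> k then (- A_pow 3) ^ nat k else (- A_pow (- 3)) ^ nat (- k))"

definition polys_A_d1 :: "poly_Ad set" where
  "polys_A_d1 = {p. \<forall>(k, m) \<in> Poly_Mapping.keys p. Poly_Mapping.keys m \<subseteq> {1}}"

definition double_bracket_cut :: "vlink \<Rightarrow> cut_point set \<Rightarrow> poly_Ad" where
  "double_bracket_cut D C =
     (\<Sum>\<sigma> \<in> states D.
        A_pow (splice_difference D \<sigma>) *
        (- A_pow 2 - A_pow (- 2)) ^ (num_loops D \<sigma> - 1) *
        (\<Prod>i | 1 \<le> i \<and> num_loops_of_index D C \<sigma> i \<noteq> 0.
           d_var i ^ num_loops_of_index D C \<sigma> i))"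

text \<open>The common value for all cut systems. A cut system exists, and the value does not depend on it (N. Kamada), so the description is proper.\<close>

definition double_bracket :: "vlink \<Rightarrow> poly_Ad" where
  "double_bracket D = (THE x. \<exists>C. cut_system D C \<and> x = double_bracket_cut D C)"

definition multivariable_poly :: "vlink \<Rightarrow> poly_Ad" where
  "multivariable_poly D = minus_A3_pow (- writhe D) * double_bracket D"

end

theory Submission
  imports Defs
begin

text \<open>
  Let \<open>f\<close> be a numbering of \<open>D\<close> cut at \<open>C\<close>. Along a loop of a state the value of \<open>f\<close> changes
  at cut points and at the splices; an oriented splice joins equally numbered arcs, and the change
  at the other splice depends only on the crossing and on the direction of travel. The total change
  around the loop is 0, so the signed number of cut points is determined by the state alone, and the
  double bracket does not depend on the cut system. For \<open>make_virtual D\<^sub>0 c\<close> the Alexander numbering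
  of \<open>D\<^sub>0\<close> becomes a numbering once a single cut point is placed on each of the two strands at
  \<open>c\<close>. With two cut points every index is at most 1.
\<close>

section \<open>Marks on a circle\<close>

text \<open>The circle is cut open at parameter 0, so a cyclic predecessor is either the nearest
  smaller mark or, if there is none, the largest mark. Later proofs treat the two cases with the
  linear order alone.\<close>

lemma pred_mark_cases:
  assumes "finite M" "M \<noteq> {}"
  obtains (below) "pred_mark M t \<in> M" "pred_mark M t < t"
      "\<And>m. m \<in> M \<Longrightarrow> m < t \<Longrightarrow> m \<le> pred_mark M t"
    | (wrap) "pred_mark M t \<in> M" "\<And>m. m \<in> M \<Longrightarrow> t \<le> m" "pred_mark M t = Max M"
proof (cases "\<exists>m \<in> M. m < t")
  case True
  then have "pred_mark M t = Max {m \<in> M. m < t}" "{m \<in> M. m < t} \<noteq> {}"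
    by (auto simp: pred_mark_def)
  moreover have "finite {m \<in> M. m < t}"
    using assms by simp
  ultimately show ?thesis
    using that(1) Max_in[of "{m \<in> M. m < t}"] Max_ge[of "{m \<in> M. m < t}"] by auto
next
  case False
  then show ?thesis
    using that(2) assms Max_in[of M] by (force simp: pred_mark_def)
qed

lemma succ_mark_cases:
  assumes "finite M" "M \<noteq> {}"
  obtains (above) "succ_mark M t \<in> M" "t < succ_mark M t"
      "\<And>m. m \<in> M \<Longrightarrow> t < m \<Longrightarrow> succ_mark M t \<le> m"
    | (wrap) "succ_mark M t \<in> M" "\<And>m. m \<in> M \<Longrightarrow> m \<le> t" "succ_mark M t = Min M"
proof (cases "\<exists>m \<in> M. t < m")
  case True
  then have "succ_mark M t = Min {m \<in> M. t < m}" "{m \<in> M. t < m} \<noteq> {}"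
    by (auto simp: succ_mark_def)
  moreover have "finite {m \<in> M. t < m}"
    using assms by simp
  ultimately show ?thesis
    using that(1) Min_in[of "{m \<in> M. t < m}"] Min_le[of "{m \<in> M. t < m}"] by auto
next
  case False
  then show ?thesis
    using that(2) assms Min_in[of M] by (force simp: succ_mark_def)
qed

lemma pred_mark_eqI:
  assumes "finite M" "u \<in> M" "u < t" "\<And>m. m \<in> M \<Longrightarrow> m < t \<Longrightarrow> m \<le> u"
  shows "pred_mark M t = u"
proof -
  have "Max {m \<in> M. m < t} = u"
    using assms by (intro Max_eqI) auto
  then show ?thesis
    using assms by (auto simp: pred_mark_def)
qed

lemma pred_mark_wrap: "(\<And>m. m \<in> M \<Longrightarrow> t \<le> m) \<Longrightarrow> pred_mark M t = Max M"
  by (force simp: pred_mark_def)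

lemma succ_mark_eqI:
  assumes "finite M" "u \<in> M" "t < u" "\<And>m. m \<in> M \<Longrightarrow> t < m \<Longrightarrow> u \<le> m"
  shows "succ_mark M t = u"
proof -
  have "Min {m \<in> M. t < m} = u"
    using assms by (intro Min_eqI) auto
  then show ?thesis
    using assms by (auto simp: succ_mark_def)
qed

lemma succ_mark_wrap: "(\<And>m. m \<in> M \<Longrightarrow> m \<le> t) \<Longrightarrow> succ_mark M t = Min M"
  by (force simp: succ_mark_def)

lemma pred_mark_in: "finite M \<Longrightarrow> M \<noteq> {} \<Longrightarrow> pred_mark M t \<in> M"
  by (rule pred_mark_cases[of M t]) auto

lemma succ_mark_in: "finite M \<Longrightarrow> M \<noteq> {} \<Longrightarrow> succ_mark M t \<in> M"
  by (rule succ_mark_cases[of M t]) auto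

text \<open>Arcs are named by their starting mark; this recovers the name from the final mark. If
  \<open>t\<close> is the largest mark, both steps wrap around.\<close>

lemma pred_succ_mark:
  assumes "finite M" "t \<in> M"
  shows "pred_mark M (succ_mark M t) = t"
proof -
  have "M \<noteq> {}" using assms by auto
  from assms(1) this show ?thesis
  proof (cases rule: succ_mark_cases[where t = t])
    case above
    then show ?thesis using assms by (intro pred_mark_eqI) (auto simp: not_less[symmetric])
  next
    case wrap
    moreover have "Max M = t" using assms wrap by (intro Max_eqI) auto
    ultimately show ?thesis
      using assms by (subst pred_mark_wrap) auto
  qed
qed

lemma succ_pred_mark:
  assumes "finite M" "t \<in> M"
  shows "succ_mark M (pred_mark M t) = t"
proof -
  have "M \<noteq> {}" using assms by auto
  from assms(1) this show ?thesis
  proof (cases rule: pred_mark_cases[where t = t])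
    case below
    then show ?thesis using assms by (intro succ_mark_eqI) (auto simp: not_less[symmetric])
  next
    case wrap
    moreover have "Min M = t" using assms wrap by (intro Min_eqI) auto
    ultimately show ?thesis
      using assms by (subst succ_mark_wrap) auto
  qed
qed

text \<open>Predecessors depend only on the order of the marks, so marks may slide along the circle
  as long as none overtakes another.\<close>

lemma pred_mark_image:
  assumes "finite M" "strict_mono_on M \<phi>" "t \<in> M"
  shows "pred_mark (\<phi> ` M) (\<phi> t) = \<phi> (pred_mark M t)"
proof -
  have less: "\<phi> x < \<phi> y \<longleftrightarrow> x < y" "\<phi> x \<le> \<phi> y \<longleftrightarrow> x \<le> y" if "x \<in> M" "y \<in> M" for x y
    using that assms(2) strict_mono_on_less strict_mono_on_less_eq by blast+
  have "M \<noteq> {}" using assms by auto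
  from assms(1) this show ?thesis
  proof (cases rule: pred_mark_cases[where t = t])
    case below
    then show ?thesis using assms by (intro pred_mark_eqI) (auto simp: less)
  next
    case wrap
    then have "pred_mark (\<phi> ` M) (\<phi> t) = Max (\<phi> ` M)"
      using assms by (intro pred_mark_wrap) (auto simp: less)
    also have "\<dots> = \<phi> (pred_mark M t)"
      using assms wrap by (intro Max_eqI) (auto simp: less)
    finally show ?thesis .
  qed
qed

section \<open>Telescoping sums over marks on a circle\<close>

lemma sum_marks_below:
  fixes g :: "real \<Rightarrow> int"
  assumes "finite M"
  shows "(\<Sum>m | m \<in> M \<and> m < y. g m - g (pred_mark M m)) = g (pred_mark M y) - g (Max M)"
\<comment> \<open>Peel off the largest mark below \<open>y\<close>; its own predecessor is where the
  remaining sum stops. With no mark below \<open>y\<close>, the predecessor wraps to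
  \<open>Max M\<close> and both sides are 0.\<close>
proof (induction "card {m \<in> M. m < y}" arbitrary: y rule: less_induct)
  case less
  show ?case
  proof (cases "\<exists>m \<in> M. m < y")
    case False
    then have "{m. m \<in> M \<and> m < y} = {}" "pred_mark M y = Max M"
      by (auto simp: pred_mark_def)
    then show ?thesis by (simp only:) simp
  next
    case True
    define u where "u = pred_mark M y"
    from True have "M \<noteq> {}" by auto
    with assms have u: "u \<in> M" "u < y" "\<And>m. m \<in> M \<Longrightarrow> m < y \<Longrightarrow> m \<le> u"
      using True unfolding u_def by (cases rule: pred_mark_cases[where t = y]; force)+
    then have split: "{m \<in> M. m < y} = insert u {m \<in> M. m < u}"
      by force
    then have "card {m \<in> M. m < u} < card {m \<in> M. m < y}"
      using assms by simp
    from less[OF this] split assms show ?thesis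
      by (simp add: u_def)
  qed
qed

lemma sum_marks:
  fixes g :: "real \<Rightarrow> int"
  assumes "finite M"
  shows "(\<Sum>m\<in>M. g m - g (pred_mark M m)) = 0"
proof (cases "M = {}")
  case False
  \<comment> \<open>\<open>Max M + 1\<close> lies beyond every mark, so the partial sum below it is
    the whole sum, and its predecessor is \<open>Max M\<close>.\<close>
  have "m < Max M + 1" if "m \<in> M" for m
    using Max_ge[OF assms that] by linarith
  then have "{m \<in> M. m < Max M + 1} = M"
    by auto
  moreover have "pred_mark M (Max M + 1) = Max M"
    using assms False by (intro pred_mark_eqI) auto
  ultimately show ?thesis
    using sum_marks_below[OF assms, where g = g and y = "Max M + 1"] by simp
qed simp

lemma sum_marks_above:
  fixes g :: "real \<Rightarrow> int"
  assumes "finite M" "x \<in> M"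
  shows "(\<Sum>m | m \<in> M \<and> x < m. g m - g (pred_mark M m)) = g (Max M) - g x"
proof -
  let ?h = "\<lambda>m. g m - g (pred_mark M m)"
  have "sum ?h M = sum ?h ({m \<in> M. m < x} \<union> {x} \<union> {m \<in> M. x < m})"
    using assms by (intro sum.cong) auto
  also have "\<dots> = sum ?h {m \<in> M. m < x} + ?h x + sum ?h {m \<in> M. x < m}"
    using assms by (subst sum.union_disjoint; force)+
  finally show ?thesis
    using sum_marks[OF assms(1), of g] sum_marks_below[OF assms(1), of g x] by simp
qed

lemma sum_marks_between:
  fixes g :: "real \<Rightarrow> int"
  assumes "finite M" "x \<in> M" "x < y"
  shows "(\<Sum>m | m \<in> M \<and> x < m \<and> m < y. g m - g (pred_mark M m)) = g (pred_mark M y) - g x"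
proof -
  let ?h = "\<lambda>m. g m - g (pred_mark M m)"
  have "sum ?h {m \<in> M. m < y} = sum ?h ({m \<in> M. m < x} \<union> {x} \<union> {m \<in> M. x < m \<and> m < y})"
    using assms by (intro sum.cong) auto
  also have "\<dots> = sum ?h {m \<in> M. m < x} + ?h x + sum ?h {m \<in> M. x < m \<and> m < y}"
    using assms by (subst sum.union_disjoint; force)+
  finally show ?thesis
    using sum_marks_below[OF assms(1), of g x] sum_marks_below[OF assms(1), of g y] by simp
qed

text \<open>\<open>M\<close> refines \<open>N\<close>, and the jumps inside one arc of
  \<open>N\<close> telescope up to the last mark of \<open>M\<close> before that arc ends. With the
  classical passages as \<open>N\<close> and the cut points added in \<open>M\<close>, this is the
  net change of a numbering along a semi-arc.\<close>

lemma sum_marks_in_arc: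
  fixes g :: "real \<Rightarrow> int"
  assumes "finite M" "N \<subseteq> M" "t \<in> N"
  shows "(\<Sum>m | m \<in> M - N \<and> pred_mark N m = t. g m - g (pred_mark M m))
    = g (pred_mark M (succ_mark N t)) - g t"
proof -
  let ?h = "\<lambda>m. g m - g (pred_mark M m)"
  define s where "s = succ_mark N t"
  have fin: "finite N" and ne: "N \<noteq> {}" and t: "t \<in> M"
    using assms finite_subset by auto
  show ?thesis
    using fin ne
  proof (cases rule: succ_mark_cases[where t = t])
    case above
    note s = above[folded s_def]
    have "{m. m \<in> M - N \<and> pred_mark N m = t} = {m \<in> M. t < m \<and> m < s}"
    proof (intro equalityI subsetI; clarsimp)
      fix m assume m: "m \<in> M" "m \<notin> N" "t = pred_mark N m"
      from fin ne show "pred_mark N m < m \<and> m < s"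
      proof (cases rule: pred_mark_cases[where t = m])
        case below
        then show ?thesis using s m by (metis linorder_less_linear not_less)
      next
        case wrap
        then show ?thesis using s m by (metis Max_ge fin not_less)
      qed
    next
      fix m assume m: "m \<in> M" "t < m" "m < s"
      show "m \<notin> N \<and> pred_mark N m = t"
        using m s fin assms pred_mark_eqI[of N t m] by force
    qed
    then show ?thesis
      using sum_marks_between[OF assms(1) t s(2), of g] by (simp add: s_def)
  next
    case wrap
    note s = wrap[folded s_def]
    have Max: "Max N = t"
      using s fin assms by (intro Max_eqI) auto
    have s_le: "s \<le> m" if "m \<in> N" for m
      using that fin s by simp
    \<comment> \<open>Here \<open>t\<close> is the largest mark of \<open>N\<close> and the arc runs
      through parameter 0. Its interior consists of two intervals, and the values at
      \<open>Max M\<close> cancel between their sums.\<close>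
    have "{m. m \<in> M - N \<and> pred_mark N m = t} = {m \<in> M. t < m} \<union> {m \<in> M. m < s}"
    proof (intro equalityI subsetI)
      fix m assume m: "m \<in> {m. m \<in> M - N \<and> pred_mark N m = t}"
      from fin ne have "t < m \<or> m < s"
      proof (cases rule: pred_mark_cases[where t = m])
        case below
        then show ?thesis using m by simp
      next
        case wrap
        from wrap(2)[OF s(1)] show ?thesis using m s(1) by (cases "m = s") auto
      qed
      then show "m \<in> {m \<in> M. t < m} \<union> {m \<in> M. m < s}"
        using m by auto
    next
      fix m assume m: "m \<in> {m \<in> M. t < m} \<union> {m \<in> M. m < s}"
      then consider "t < m" | "m < s" by auto
      then have "m \<notin> N \<and> pred_mark N m = t"
      proof cases
        case 1
        then have "pred_mark N m = t"
          using fin assms(3) s(2) by (intro pred_mark_eqI) auto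
        with 1 show ?thesis using s(2)[of m] by auto
      next
        case 2
        then have "m \<le> n" if "n \<in> N" for n using s_le[OF that] by simp
        then have "pred_mark N m = t"
          using Max pred_mark_wrap[of N m] by auto
        with 2 show ?thesis using s_le[of m] by auto
      qed
      then show "m \<in> {m. m \<in> M - N \<and> pred_mark N m = t}"
        using m by auto
    qed
    moreover have "sum ?h ({m \<in> M. t < m} \<union> {m \<in> M. m < s})
      = sum ?h {m \<in> M. t < m} + sum ?h {m \<in> M. m < s}"
      using assms s_le[OF assms(3)] by (intro sum.union_disjoint) auto
    ultimately show ?thesis
      using sum_marks_above[OF assms(1) t, of g] sum_marks_below[OF assms(1), of g s]
      by (simp add: s_def)
  qed
qed

section \<open>Crossings\<close>

lemma finite_passages:
  assumes "vlink_diagram D" "z \<in> crossings D"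
  shows "finite (passages D z)"
  using assms by (intro card_ge_0_finite) (auto simp: vlink_diagram_def)

lemma classical_subset_crossings: "classical D \<subseteq> crossings D"
  by (auto simp: classical_def)

lemma finite_crossing_passages:
  assumes "vlink_diagram D"
  shows "finite {p \<in> points D. location D p \<in> crossings D}"
proof -
  have "{p \<in> points D. location D p \<in> crossings D} = (\<Union>z \<in> crossings D. passages D z)"
    by (auto simp: passages_def)
  then show ?thesis
    using assms finite_passages[OF assms] by (auto simp: vlink_diagram_def)
qed

lemma finite_cmarks:
  assumes "vlink_diagram D"
  shows "finite (cmarks D k)"
proof -
  have "cmarks D k \<subseteq> snd ` {p \<in> points D. location D p \<in> crossings D}"
    using classical_subset_crossings[of D] by (force simp: cmarks_def)
  then show ?thesis
    using finite_crossing_passages[OF assms] finite_surj by blast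
qed

text \<open>By transversality and antisymmetry of \<open>plane_det\<close>, exactly one ordering of
  the two passages has positive determinant. Hence both definite descriptions are proper.\<close>

lemma passages_crossing:
  assumes "vlink_diagram D" "z \<in> crossings D"
  shows "rising_right D z \<noteq> rising_left D z"
    and "passages D z = {rising_right D z, rising_left D z}"
proof -
  have "card (passages D z) = 2"
    using assms by (auto simp: vlink_diagram_def)
  then obtain a b where ab: "passages D z = {a, b}" "a \<noteq> b"
    by (auto simp: card_2_iff)
  have antisym: "plane_det v w = - plane_det w v" for v w
    by (simp add: plane_det_def)
  have self: "plane_det v v = 0" for v
    by (simp add: plane_det_def)
  have "\<exists>p q. passages D z = {p, q} \<and> p \<noteq> q \<and> plane_det (velocity D p) (velocity D q) > 0"
  proof (cases "plane_det (velocity D a) (velocity D b) > 0")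
    case False
    moreover have "plane_det (velocity D a) (velocity D b) \<noteq> 0"
      using assms ab by (auto simp: vlink_diagram_def)
    ultimately have "plane_det (velocity D b) (velocity D a) > 0"
      using antisym[of "velocity D a" "velocity D b"] by linarith
    then show ?thesis using ab by blast
  qed (use ab in blast)
  then obtain p q where pq: "passages D z = {p, q}" "p \<noteq> q"
    "plane_det (velocity D p) (velocity D q) > 0" "\<not> plane_det (velocity D q) (velocity D p) > 0"
    using antisym by (metis less_asym neg_0_less_iff_less)
  have "rising_right D z = p"
    unfolding rising_right_def using pq self by (intro the_equality) auto
  moreover have "rising_left D z = q"
    unfolding rising_left_def using pq self by (intro the_equality) auto
  ultimately show "rising_right D z \<noteq> rising_left D z"
    and "passages D z = {rising_right D z, rising_left D z}"
    using pq by auto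
qed

lemma partner:
  assumes "vlink_diagram D" "z \<in> crossings D" "p \<in> passages D z"
  shows "partner D p = (if p = rising_right D z then rising_left D z else rising_right D z)"
    and "partner D p \<in> passages D z" and "partner D (partner D p) = p"
proof -
  have eq: "partner D p = (if p = rising_right D z then rising_left D z else rising_right D z)"
    if "p \<in> passages D z" for p
  proof -
    have "location D p = z" using that by (simp add: passages_def)
    moreover note passages_crossing[OF assms(1,2)] that
    ultimately show ?thesis
      unfolding partner_def by (intro the_equality) (metis empty_iff insert_iff)+
  qed
  show "partner D p = (if p = rising_right D z then rising_left D z else rising_right D z)"
    and p: "partner D p \<in> passages D z"
    using eq[OF assms(3)] passages_crossing[OF assms(1,2)] by (metis insertCI)+
  show "partner D (partner D p) = p"
    using eq[OF assms(3)] eq[OF p] assms(3) passages_crossing[OF assms(1,2)]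
    by (metis empty_iff insert_iff)
qed

section \<open>Tracing the loops of a state\<close>

definition classical_passages :: "vlink \<Rightarrow> passage set" where
  "classical_passages D = {p \<in> points D. location D p \<in> classical D}"

lemma classical_passages_iff_cmarks: "(k, t) \<in> classical_passages D \<longleftrightarrow> t \<in> cmarks D k"
  by (simp add: classical_passages_def cmarks_def)

lemma classical_passagesD:
  assumes "p \<in> classical_passages D"
  shows "location D p \<in> crossings D" "p \<in> passages D (location D p)"
    and "snd p \<in> cmarks D (fst p)" "fst p < ncomp D"
  using assms classical_subset_crossings
  by (auto simp: classical_passages_def passages_def cmarks_def points_def)

lemma partner_classical:
  assumes "vlink_diagram D" "p \<in> classical_passages D"
  shows "partner D p \<in> classical_passages D" "location D (partner D p) = location D p"
    and "partner D (partner D p) = p"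
  using partner[OF assms(1) classical_passagesD(1,2)[OF assms(2)]] assms(2)
  by (auto simp: classical_passages_def passages_def)

lemma finite_semi_arcs:
  assumes "vlink_diagram D"
  shows "finite (semi_arcs D)"
proof -
  have "semi_arcs D \<subseteq> (\<Union>k<ncomp D. Arc k ` cmarks D k) \<union> Loop ` {..<ncomp D}"
    by (auto simp: semi_arcs_def)
  then show ?thesis
    by (rule finite_subset) (use finite_cmarks[OF assms] in auto)
qed

text \<open>The directed semi-arc that leaves \<open>p\<close> in direction \<open>b\<close>.
  Reversing its flag gives a directed semi-arc that arrives at \<open>p\<close>, so one notion
  describes both sides of a splice.\<close>

definition departure :: "vlink \<Rightarrow> passage \<Rightarrow> bool \<Rightarrow> arc \<times> bool" where
  "departure D p b = (if b then arc_after p else arc_before (cmarks D) p, b)"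

lemma departure_in:
  assumes "vlink_diagram D" "p \<in> classical_passages D"
  shows "fst (departure D p b) \<in> semi_arcs D"
  using classical_passagesD(3,4)[OF assms(2)] finite_cmarks[OF assms(1)] pred_mark_in
  by (force simp: departure_def arc_after_def arc_before_def semi_arcs_def)

lemma semi_arc_cases:
  assumes "vlink_diagram D" "x \<in> semi_arcs D \<times> UNIV"
  obtains (Loop) k b where "x = (Loop k, b)" "k < ncomp D" "cmarks D k = {}"
  | (Arc) p b where "p \<in> classical_passages D" "x = apsnd Not (departure D p b)"
proof -
  obtain a b where x: "x = (a, b)" "a \<in> semi_arcs D"
    using assms(2) by auto
  show ?thesis
  proof (cases a)
    case (Loop k)
    then show ?thesis using x that(1) by (auto simp: semi_arcs_def)
  next
    case (Arc k t)
    then have t: "t \<in> cmarks D k"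
      using x by (auto simp: semi_arcs_def)
    \<comment> \<open>The passage at which the semi-arc ends in the direction of travel: the next
      mark when going forward, the starting mark when going backward.\<close>
    define p where "p = (k, if b then succ_mark (cmarks D k) t else t)"
    have "p \<in> classical_passages D"
      using t finite_cmarks[OF assms(1)] succ_mark_in[of "cmarks D k" t]
      by (auto simp: p_def classical_passages_iff_cmarks)
    moreover have "x = apsnd Not (departure D p (\<not> b))"
      using t finite_cmarks[OF assms(1)] x Arc
      by (auto simp: p_def departure_def arc_after_def arc_before_def pred_succ_mark)
    ultimately show ?thesis using that(2) by blast
  qed
qed

text \<open>Arrival at \<open>p\<close> happens with flag \<open>\<not> b\<close>; the oriented
  splice keeps the flag and the other splice flips it.\<close>

lemma trace_step_departure:
  assumes "vlink_diagram D" "p \<in> classical_passages D"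
  shows "trace_step D \<sigma> (apsnd Not (departure D p b)) =
    departure D (partner D p) (if oriented_splice D \<sigma> (location D p) then \<not> b else b)"
proof -
  have "snd p \<in> cmarks D (fst p)" "finite (cmarks D (fst p))"
    using assms finite_cmarks classical_passagesD by auto
  then show ?thesis
    by (auto simp: departure_def arc_after_def arc_before_def succ_pred_mark Let_def)
qed

lemma trace_step_in:
  assumes "vlink_diagram D" "x \<in> semi_arcs D \<times> UNIV"
  shows "trace_step D \<sigma> x \<in> semi_arcs D \<times> UNIV"
  using assms
proof (cases rule: semi_arc_cases)
  case (Arc p b)
  then show ?thesis
    using departure_in[OF assms(1)] partner_classical[OF assms(1)]
    by (simp add: trace_step_departure[OF assms(1)] mem_Times_iff)
qed (use assms in auto)

text \<open>Walking back undoes a step, because \<open>partner\<close> is an involution and the kind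
  of splice depends only on the crossing. This is the source of injectivity of
  \<open>trace_step\<close>.\<close>

lemma trace_step_reverse:
  assumes "vlink_diagram D" "x \<in> semi_arcs D \<times> UNIV"
  shows "apsnd Not (trace_step D \<sigma> (apsnd Not (trace_step D \<sigma> x))) = x"
  using assms
proof (cases rule: semi_arc_cases)
  case (Arc p b)
  then show ?thesis
    by (simp add: trace_step_departure partner_classical assms(1))
qed auto

text \<open>An injective self-map of a finite set is bijective. The bijection permits shifting a sum
  around a loop by one step.\<close>

lemma trace_step_permutes_loop:
  assumes "vlink_diagram D" "L \<in> directed_loops D \<sigma>"
  shows "L \<subseteq> semi_arcs D \<times> UNIV" "bij_betw (trace_step D \<sigma>) L L"
proof -
  obtain x where x: "x \<in> semi_arcs D \<times> UNIV" "L = orbit (trace_step D \<sigma>) x"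
    using assms(2) by (auto simp: directed_loops_def)
  \<comment> \<open>The inductive set \<open>orbit\<close> starts at
    \<open>trace_step D \<sigma> x\<close> rather than at \<open>x\<close>.\<close>
  have "y \<in> semi_arcs D \<times> UNIV" if "y \<in> orbit (trace_step D \<sigma>) x" for y
    using that by induction (use x trace_step_in[OF assms(1)] in auto)
  then show sub: "L \<subseteq> semi_arcs D \<times> UNIV"
    using x by auto
  then have "finite L"
    using finite_semi_arcs[OF assms(1)] finite_subset by fastforce
  moreover have "inj_on (trace_step D \<sigma>) L"
    using sub trace_step_reverse[OF assms(1)] by (intro inj_onI) (metis subsetD)
  moreover have "trace_step D \<sigma> ` L \<subseteq> L"
    using x by (auto intro: orbit.step)
  ultimately show "bij_betw (trace_step D \<sigma>) L L"
    by (simp add: bij_betw_def endo_inj_surj)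
qed

section \<open>Independence of the cut system\<close>

text \<open>Names the numbering that \<open>cut_system\<close> only asserts to exist, so that cut
  counts can be expressed through its values.\<close>

definition cut_numbering :: "vlink \<Rightarrow> cut_point set \<Rightarrow> (arc \<Rightarrow> int) \<Rightarrow> bool" where
  "cut_numbering D C f \<longleftrightarrow> finite C \<and> inj_on fst C \<and>
     (\<forall>p \<in> fst ` C. p \<in> points D \<and> location D p \<notin> crossings D) \<and> alexander_numbering D C f"

lemma cut_system_iff: "cut_system D C \<longleftrightarrow> (\<exists>f. cut_numbering D C f)"
  by (auto simp: cut_system_def cut_numbering_def)

lemma finite_cut_marks:
  assumes "vlink_diagram D" "finite C"
  shows "finite (cut_marks D C k)"
proof -
  have "{t. (k, t) \<in> fst ` C} \<subseteq> snd ` fst ` C"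
    by force
  then have "finite {t. (k, t) \<in> fst ` C}"
    by (rule finite_subset) (use assms in simp)
  then show ?thesis
    unfolding cut_marks_def using finite_cmarks[OF assms(1)] by simp
qed

section \<open>Cut counts as differences of a numbering\<close>

lemma cut_point_jump:
  assumes "alexander_numbering D C f" "((k, t), b) \<in> C"
  shows "f (Arc k t) - f (Arc k (pred_mark (cut_marks D C k) t)) = (if b then 1 else - 1)"
proof -
  have "f (arc_after (k, t)) = f (arc_before (cut_marks D C) (k, t)) + (if b then 1 else - 1)"
    using assms unfolding alexander_numbering_def by fast
  moreover have "cut_marks D C k \<noteq> {}"
    using assms(2) by (force simp: cut_marks_def)
  ultimately show ?thesis
    by (auto simp: arc_after_def arc_before_def)
qed

text \<open>Cut points avoid crossings, so they are exactly the marks outside \<open>cmarks\<close>,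
  and the sign of each is the jump of \<open>f\<close> there. The predicate \<open>P\<close> selects
  the cut points on \<open>a\<close>, which treats whole components and proper arcs alike.\<close>

lemma cut_count_eq_sum_marks:
  assumes "vlink_diagram D" "cut_numbering D C f"
    and "\<And>p. p \<in> fst ` C \<Longrightarrow> arc_before (cmarks D) p = a \<longleftrightarrow> fst p = k \<and> P (snd p)"
  shows "cut_count D C a = (\<Sum>m | m \<in> cut_marks D C k - cmarks D k \<and> P m.
    f (Arc k m) - f (Arc k (pred_mark (cut_marks D C k) m)))"
  unfolding cut_count_def
\<comment> \<open>Since \<open>fst\<close> is injective on \<open>C\<close>, the position determines
  the direction; it is read off by asking whether the forward cut point at \<open>m\<close> belongs
  to \<open>C\<close>.\<close>
proof (rule sum.reindex_cong[where l = "\<lambda>m. ((k, m), ((k, m), True) \<in> C)"])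
  have C: "inj_on fst C" "alexander_numbering D C f"
    "\<And>p. p \<in> fst ` C \<Longrightarrow> location D p \<notin> crossings D"
    using assms(2) by (auto simp: cut_numbering_def)
  show "inj_on (\<lambda>m. ((k, m), ((k, m), True) \<in> C)) {m. m \<in> cut_marks D C k - cmarks D k \<and> P m}"
    by (auto simp: inj_on_def)
  have "t \<notin> cmarks D k" if "(k, t) \<in> fst ` C" for t
    using C(3)[OF that] classical_subset_crossings[of D] by (auto simp: cmarks_def)
  then have marks: "cut_marks D C k - cmarks D k = {t. (k, t) \<in> fst ` C}"
    unfolding cut_marks_def by blast
  have orient: "(((k, m), True) \<in> C) = b" if "((k, m), b) \<in> C" for m b
    using that inj_onD[OF C(1), of "((k, m), True)" "((k, m), False)"] by (cases b) auto
  show "{c \<in> C. arc_before (cmarks D) (fst c) = a}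
    = (\<lambda>m. ((k, m), ((k, m), True) \<in> C)) ` {m. m \<in> cut_marks D C k - cmarks D k \<and> P m}"
    unfolding marks
  proof (intro equalityI subsetI)
    fix c assume "c \<in> {c \<in> C. arc_before (cmarks D) (fst c) = a}"
    moreover obtain i m b where c: "c = ((i, m), b)"
      by (metis surj_pair)
    ultimately have *: "((i, m), b) \<in> C" "i = k" "P m"
      using assms(3)[of "(i, m)"] image_eqI[of "(i, m)" fst c C] by auto
    then have "c = ((k, m), ((k, m), True) \<in> C)"
      using orient c by auto
    then show "c \<in> (\<lambda>m. ((k, m), ((k, m), True) \<in> C)) ` {m. m \<in> {t. (k, t) \<in> fst ` C} \<and> P m}"
      using * by (intro image_eqI[of _ _ m]) force+
  next
    fix c assume "c \<in> (\<lambda>m. ((k, m), ((k, m), True) \<in> C)) ` {m. m \<in> {t. (k, t) \<in> fst ` C} \<and> P m}"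
    then obtain m b where "c = ((k, m), ((k, m), True) \<in> C)" "((k, m), b) \<in> C" "P m"
      by auto
    then show "c \<in> {c \<in> C. arc_before (cmarks D) (fst c) = a}"
      using orient[of m b] assms(3)[of "(k, m)"] image_eqI[of "(k, m)" fst c C] by auto
  qed
  fix m assume "m \<in> {m. m \<in> cut_marks D C k - cmarks D k \<and> P m}"
  then obtain b where "((k, m), b) \<in> C"
    using marks by auto
  then show "(case ((k, m), ((k, m), True) \<in> C) of (p, forward) \<Rightarrow> if forward then 1 else - 1)
    = f (Arc k m) - f (Arc k (pred_mark (cut_marks D C k) m))"
    using cut_point_jump[OF C(2)] orient by auto
qed

text \<open>Without classical passages the cut points are the only places where \<open>f\<close>
  changes, and these changes add up to 0 around the circle.\<close>

lemma cut_count_Loop: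
  assumes "vlink_diagram D" "cut_numbering D C f" "cmarks D k = {}"
  shows "cut_count D C (Loop k) = 0"
proof -
  have "cut_count D C (Loop k) = (\<Sum>m | m \<in> cut_marks D C k - cmarks D k \<and> True.
      f (Arc k m) - f (Arc k (pred_mark (cut_marks D C k) m)))"
    using assms by (intro cut_count_eq_sum_marks) (auto simp: arc_before_def)
  then show ?thesis
    using sum_marks[OF finite_cut_marks[OF assms(1)], of C "\<lambda>m. f (Arc k m)" k] assms
    by (simp add: cut_numbering_def)
qed

text \<open>The jumps telescope from the first piece of the semi-arc to its last piece, the one
  ending at the next classical passage.\<close>

lemma cut_count_Arc:
  assumes "vlink_diagram D" "cut_numbering D C f" "t \<in> cmarks D k"
  shows "cut_count D C (Arc k t)
    = f (arc_before (cut_marks D C) (k, succ_mark (cmarks D k) t)) - f (Arc k t)"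
proof -
  have "cut_count D C (Arc k t)
      = (\<Sum>m | m \<in> cut_marks D C k - cmarks D k \<and> pred_mark (cmarks D k) m = t.
      f (Arc k m) - f (Arc k (pred_mark (cut_marks D C k) m)))"
    using assms by (intro cut_count_eq_sum_marks) (auto simp: arc_before_def)
  also have "\<dots> = f (Arc k (pred_mark (cut_marks D C k) (succ_mark (cmarks D k) t))) - f (Arc k t)"
    using assms finite_cut_marks[OF assms(1)]
    by (intro sum_marks_in_arc) (auto simp: cut_marks_def cut_numbering_def)
  finally show ?thesis
    using assms(3) by (auto simp: arc_before_def cut_marks_def)
qed

text \<open>The value at the end of an arc is the start value of the reversed arc.\<close>

fun start_value :: "vlink \<Rightarrow> cut_point set \<Rightarrow> (arc \<Rightarrow> int) \<Rightarrow> arc \<times> bool \<Rightarrow> int" where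
  "start_value D C f (Loop k, b) = 0"
| "start_value D C f (Arc k t, b) = (if b then f (Arc k t)
     else f (arc_before (cut_marks D C) (k, succ_mark (cmarks D k) t)))"

lemma start_value_departure:
  assumes "vlink_diagram D" "p \<in> classical_passages D"
  shows "start_value D C f (departure D p b)
    = f (if b then arc_after p else arc_before (cut_marks D C) p)"
proof -
  have "snd p \<in> cmarks D (fst p)" "finite (cmarks D (fst p))"
    using assms finite_cmarks classical_passagesD by auto
  then show ?thesis
    by (auto simp: departure_def arc_after_def succ_pred_mark arc_before_def[of "cmarks D"])
qed

text \<open>Reversing the travel swaps start and end value, which matches the sign. For a whole
  component both start values are the default 0, in agreement with its cut count.\<close>

lemma signed_cut_count:
  assumes "vlink_diagram D" "cut_numbering D C f" "x \<in> semi_arcs D \<times> UNIV"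
  shows "(if snd x then 1 else - 1) * cut_count D C (fst x)
    = start_value D C f (apsnd Not x) - start_value D C f x"
proof -
  obtain a b where x: "x = (a, b)" "a \<in> semi_arcs D"
    using assms(3) by auto
  then show ?thesis
    using assms by (cases a) (auto simp: semi_arcs_def cut_count_Loop cut_count_Arc)
qed

text \<open>The first two equations say that the ends joined by the oriented splice carry equal
  numbers. In the third the jump along a strand is a sign fixed by the diagram, whatever
  \<open>f\<close> is.\<close>

lemma numbering_at_crossing:
  assumes "vlink_diagram D" "alexander_numbering D C f" "p \<in> classical_passages D"
  shows "f (arc_before (cut_marks D C) (partner D p)) = f (arc_after p)"
    and "f (arc_after (partner D p)) = f (arc_before (cut_marks D C) p)"
    and "f (arc_after p) = f (arc_before (cut_marks D C) p)
      + (if p = rising_right D (location D p) then 1 else - 1)"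
proof -
  let ?z = "location D p"
  have z: "?z \<in> crossings D" "p \<in> passages D ?z" "?z \<in> classical D"
    using assms(3) classical_passagesD by (auto simp: classical_passages_def)
  have "p = rising_right D ?z \<or> p = rising_left D ?z"
    using passages_crossing[OF assms(1) z(1)] z(2) by auto
  moreover have "f (arc_before (cut_marks D C) (rising_right D ?z)) = f (arc_after (rising_left D ?z))"
    "f (arc_before (cut_marks D C) (rising_left D ?z)) = f (arc_after (rising_left D ?z)) + 1"
    "f (arc_after (rising_right D ?z)) = f (arc_after (rising_left D ?z)) + 1"
    using assms(2) z(3) unfolding alexander_numbering_def by metis+
  ultimately show "f (arc_before (cut_marks D C) (partner D p)) = f (arc_after p)"
    and "f (arc_after (partner D p)) = f (arc_before (cut_marks D C) p)"
    and "f (arc_after p) = f (arc_before (cut_marks D C) p)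
      + (if p = rising_right D (location D p) then 1 else - 1)"
    using partner(1)[OF assms(1) z(1,2)] passages_crossing(1)[OF assms(1) z(1)] by auto
qed

text \<open>The difference is the change of the numbering at the splice after \<open>x\<close>. It
  is 0 at an oriented splice; at the other splice it is the jump along the arriving strand up to a
  sign given by the direction of travel.\<close>

lemma turn_independent:
  assumes "vlink_diagram D" "cut_numbering D C f" "cut_numbering D C' f'"
    and "x \<in> semi_arcs D \<times> UNIV"
  shows "start_value D C f (apsnd Not x) - start_value D C f (trace_step D \<sigma> x)
    = start_value D C' f' (apsnd Not x) - start_value D C' f' (trace_step D \<sigma> x)"
  using assms(1,4)
proof (cases rule: semi_arc_cases)
  case (Arc p b)
  have flip: "apsnd Not (apsnd Not y) = y" for y :: "arc \<times> bool"
    by (cases y) simp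
  have "alexander_numbering D C f" and "alexander_numbering D C' f'"
    using assms by (auto simp: cut_numbering_def)
  note num = numbering_at_crossing[OF assms(1) this(1) Arc(1)]
    numbering_at_crossing[OF assms(1) this(2) Arc(1)]
  show ?thesis
    using num unfolding Arc(2) flip
    by (simp add: trace_step_departure[OF assms(1) Arc(1)] start_value_departure assms(1) Arc(1)
        partner_classical)
qed auto

lemma loop_index_independent:
  assumes "vlink_diagram D" "cut_system D C" "cut_system D C'" "L \<in> directed_loops D \<sigma>"
  shows "loop_index D C L = loop_index D C' L"
proof -
  obtain f f' where f: "cut_numbering D C f" "cut_numbering D C' f'"
    using assms by (auto simp: cut_system_iff)
  note L = trace_step_permutes_loop[OF assms(1,4)]
  \<comment> \<open>The signed cut count of a loop is rewritten as the sum of its turns, in which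
    the cut system no longer matters.\<close>
  have total: "(\<Sum>(a, forward) \<in> L. (if forward then 1 else - 1) * cut_count D C a)
      = (\<Sum>x \<in> L. start_value D C f (apsnd Not x) - start_value D C f (trace_step D \<sigma> x))"
    if "cut_numbering D C f" for C f
  proof -
    have "(\<Sum>(a, forward) \<in> L. (if forward then 1 else - 1) * cut_count D C a)
        = (\<Sum>x \<in> L. start_value D C f (apsnd Not x) - start_value D C f x)"
    proof (rule sum.cong)
      fix x assume "x \<in> L"
      then show "(case x of (a, forward) \<Rightarrow> (if forward then 1 else - 1) * cut_count D C a)
        = start_value D C f (apsnd Not x) - start_value D C f x"
        using signed_cut_count[OF assms(1) that, of x] L(1) by (auto simp only: case_prod_beta)
    qed simp
    \<comment> \<open>Summed over the loop, the start value of \<open>x\<close> may be replaced by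
      that of its successor, since \<open>trace_step\<close> permutes \<open>L\<close>.\<close>
    then show ?thesis
      using sum.reindex_bij_betw[OF L(2), of "start_value D C f"] by (simp add: sum_subtractf)
  qed
  have "(\<Sum>x \<in> L. start_value D C f (apsnd Not x) - start_value D C f (trace_step D \<sigma> x))
      = (\<Sum>x \<in> L. start_value D C' f' (apsnd Not x) - start_value D C' f' (trace_step D \<sigma> x))"
    using turn_independent[OF assms(1) f] L(1) by (intro sum.cong) auto
  then show ?thesis
    by (simp add: loop_index_def total[OF f(1)] total[OF f(2)])
qed

lemma double_bracket_cut_independent:
  assumes "vlink_diagram D" "cut_system D C" "cut_system D C'"
  shows "double_bracket_cut D C = double_bracket_cut D C'"
proof -
  have "{L \<in> directed_loops D \<sigma>. loop_index D C L = i}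
      = {L \<in> directed_loops D \<sigma>. loop_index D C' L = i}" for \<sigma> i
    using loop_index_independent[OF assms] by auto
  then have "num_loops_of_index D C \<sigma> i = num_loops_of_index D C' \<sigma> i" for \<sigma> i
    by (simp add: num_loops_of_index_def)
  then show ?thesis
    by (simp only: double_bracket_cut_def)
qed

text \<open>Independence makes the value in the definite description unique; the given
  \<open>C\<close> provides existence.\<close>

lemma double_bracket_eq:
  assumes "vlink_diagram D" "cut_system D C"
  shows "double_bracket D = double_bracket_cut D C"
  unfolding double_bracket_def
proof (rule the_equality)
  show "\<exists>C'. cut_system D C' \<and> double_bracket_cut D C = double_bracket_cut D C'"
    using assms(2) by blast
next
  fix x assume "\<exists>C'. cut_system D C' \<and> x = double_bracket_cut D C'"
  then show "x = double_bracket_cut D C"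
    using double_bracket_cut_independent[OF assms(1) _ assms(2)] by blast
qed

section \<open>Making one crossing virtual\<close>

lemma make_virtual_simps [simp]:
  "ncomp (make_virtual D c) = ncomp D" "curve (make_virtual D c) = curve D"
  "points (make_virtual D c) = points D" "location (make_virtual D c) = location D"
  "velocity (make_virtual D c) = velocity D" "passages (make_virtual D c) = passages D"
  "crossings (make_virtual D c) = crossings D" "rising_right (make_virtual D c) = rising_right D"
  "rising_left (make_virtual D c) = rising_left D"
  by (simp_all add: fun_eq_iff make_virtual_def points_def location_def velocity_def passages_def
      crossings_def rising_right_def rising_left_def)

lemma classical_make_virtual: "classical (make_virtual D c) = classical D - {c}"
  by (auto simp: classical_def) (auto simp: make_virtual_def split: if_splits)

lemma vlink_diagram_make_virtual: "vlink_diagram D \<Longrightarrow> vlink_diagram (make_virtual D c)"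
  by (auto simp: vlink_diagram_def) (auto simp: make_virtual_def split: if_splits)

lemma cmarks_make_virtual:
  "cmarks (make_virtual D c) k = {t \<in> cmarks D k. location D (k, t) \<noteq> c}"
  by (auto simp: cmarks_def classical_make_virtual)

text \<open>An open interval of parameters is infinite, whereas only finitely many parameters lie
  over crossings, virtual ones included.\<close>

lemma point_right_after_mark:
  assumes "vlink_diagram D" "p \<in> points D"
  obtains t where "snd p < t" "t < 1" "location D (fst p, t) \<notin> crossings D"
    "\<And>m. m \<in> cmarks D (fst p) \<Longrightarrow> snd p < m \<Longrightarrow> t < m"
proof -
  \<comment> \<open>The element 1 keeps the new point inside the parameter interval and bounds it
    when no mark follows \<open>p\<close>.\<close>
  define S where "S = insert 1 {m \<in> cmarks D (fst p). snd p < m}"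
  have S: "finite S" "S \<noteq> {}"
    using finite_cmarks[OF assms(1)] by (auto simp: S_def)
  have "\<And>m. m \<in> S \<Longrightarrow> snd p < m"
    using assms(2) by (auto simp: S_def points_def)
  then have "infinite ({snd p<..<Min S} - snd ` {p \<in> points D. location D p \<in> crossings D})"
    using S finite_crossing_passages[OF assms(1)] by (intro Diff_infinite_finite) auto
  from infinite_imp_nonempty[OF this] obtain t where t: "t \<in> {snd p<..<Min S}"
    "t \<notin> snd ` {p \<in> points D. location D p \<in> crossings D}"
    by blast
  have less: "t < m" if "m \<in> S" for m
    using t(1) Min_le[OF S(1) that] by auto
  have "t < 1"
    using less by (simp add: S_def)
  then have "(fst p, t) \<in> points D"
    using t(1) assms(2) by (auto simp: points_def)
  then have "location D (fst p, t) \<notin> crossings D"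
    using t(2) by force
  then show ?thesis
    using that t(1) \<open>t < 1\<close> less by (auto simp: S_def)
qed

text \<open>
  A cut point right after the new virtual crossing on each of its strands takes over the
  jump of the numbering there.
\<close>

lemma cut_system_make_virtual:
  assumes D: "vlink_diagram D" and "almost_classical D" and c: "c \<in> classical D"
  obtains C where "cut_system (make_virtual D c) C" "card C \<le> 2"
proof -
  obtain f where f: "alexander_numbering D {} f"
    using assms(2) by (auto simp: almost_classical_def)
  have "\<forall>p \<in> points D. \<exists>t. snd p < t \<and> t < 1 \<and> location D (fst p, t) \<notin> crossings D \<and>
      (\<forall>m \<in> cmarks D (fst p). snd p < m \<longrightarrow> t < m)"
    using point_right_after_mark[OF D] by metis
  from bchoice[OF this] obtain shift where
    "\<forall>p \<in> points D. snd p < shift p \<and> shift p < 1 \<and> location D (fst p, shift p) \<notin> crossings D \<and>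
      (\<forall>m \<in> cmarks D (fst p). snd p < m \<longrightarrow> shift p < m)" ..
  then have shift: "snd p < shift p" "shift p < 1" "location D (fst p, shift p) \<notin> crossings D"
    "\<And>m. m \<in> cmarks D (fst p) \<Longrightarrow> snd p < m \<Longrightarrow> shift p < m" if "p \<in> points D" for p
    using that by auto
  \<comment> \<open>\<open>\<phi>\<close> slides only the marks over \<open>c\<close>, each to a
    place before the next mark, so the order of all marks is kept.\<close>
  define \<phi> where "\<phi> k t = (if location D (k, t) = c then shift (k, t) else t)" for k t
  define push where "push p = (fst p, \<phi> (fst p) (snd p))" for p :: passage
  have mark_point: "(k, t) \<in> points D" if "t \<in> cmarks D k" for k t
    using that by (simp add: cmarks_def)
  have mono: "strict_mono_on (cmarks D k) (\<phi> k)" for k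
  proof (rule strict_mono_onI)
    fix m n assume "m \<in> cmarks D k" "n \<in> cmarks D k" "m < n"
    then have "\<phi> k m < n" "n \<le> \<phi> k n"
      using shift(1)[of "(k, n)"] shift(4)[of "(k, m)" n] mark_point by (auto simp: \<phi>_def)
    then show "\<phi> k m < \<phi> k n" by simp
  qed
  then have inj: "inj_on (\<phi> k) (cmarks D k)" for k
    by (rule strict_mono_on_imp_inj_on)
  define p q where "p = rising_right D c" and "q = rising_left D c"
  have "c \<in> crossings D"
    using c classical_subset_crossings by auto
  then have pq: "p \<noteq> q" "passages D c = {p, q}"
    unfolding p_def q_def by (rule passages_crossing[OF D])+
  then have "p \<in> passages D c" "q \<in> passages D c" by auto
  then have pq_class: "p \<in> classical_passages D" "q \<in> classical_passages D"
    and pq_loc: "location D p = c" "location D q = c"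
    using c by (auto simp: passages_def classical_passages_def)
  have push_pq: "push r \<in> points D" "location D (push r) \<notin> crossings D" if "r \<in> {p, q}" for r
  proof -
    have "r \<in> points D" "location D r = c"
      using that pq_class pq_loc by (auto simp: classical_passages_def)
    then show "push r \<in> points D" "location D (push r) \<notin> crossings D"
      using shift(1-3)[of r] by (auto simp: push_def \<phi>_def points_def)
  qed
  \<comment> \<open>Along the strand rising right the numbering goes up by 1, which calls for a
    forward cut point; along the strand rising left it goes down by 1, which calls for a backward
    one.\<close>
  define C where "C = {(push p, True), (push q, False)}"
  let ?D' = "make_virtual D c"
  \<comment> \<open>The two cut points stand in for the two lost passages, so the pieces of the new
    diagram correspond to the old semi-arcs.\<close>
  have marks: "cut_marks ?D' C k = \<phi> k ` cmarks D k" for k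
  proof -
    have "(k, t) \<in> fst ` C \<longleftrightarrow> (\<exists>m \<in> cmarks D k. location D (k, m) = c \<and> t = \<phi> k m)" for t
    proof -
      have "(m \<in> cmarks D k \<and> location D (k, m) = c) \<longleftrightarrow> (k, m) \<in> {p, q}" for m
        unfolding pq(2)[symmetric] using c by (auto simp: cmarks_def passages_def)
      then have "(\<exists>m \<in> cmarks D k. location D (k, m) = c \<and> t = \<phi> k m)
          \<longleftrightarrow> (\<exists>m. (k, m) \<in> {p, q} \<and> t = \<phi> k m)"
        by blast
      also have "\<dots> \<longleftrightarrow> (k, t) \<in> {push p, push q}"
        by (cases p; cases q) (auto simp: push_def)
      finally show ?thesis
        by (simp add: C_def)
    qed
    then have "cut_marks ?D' C k = {m \<in> cmarks D k. location D (k, m) \<noteq> c}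
        \<union> {\<phi> k m |m. m \<in> cmarks D k \<and> location D (k, m) = c}"
      unfolding cut_marks_def cmarks_make_virtual by blast
    also have "\<dots> = \<phi> k ` cmarks D k"
      by (auto simp: \<phi>_def)
    finally show ?thesis .
  qed
  \<comment> \<open>The old numbering, carried over by sliding each mark back to its original
    place.\<close>
  define f' where "f' a = (case a of Arc k t \<Rightarrow> f (Arc k (inv_into (cmarks D k) (\<phi> k) t))
    | Loop k \<Rightarrow> f (Loop k))" for a
  have before: "f' (arc_before (cut_marks ?D' C) (push r)) = f (arc_before (cut_marks D {}) r)"
    and after: "f' (arc_after (push r)) = f (arc_after r)"
    if "r \<in> classical_passages D" for r
  proof -
    have r: "snd r \<in> cmarks D (fst r)"
      by (rule classical_passagesD[OF that])
    moreover have "pred_mark (cmarks D (fst r)) (snd r) \<in> cmarks D (fst r)"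
      using pred_mark_in finite_cmarks[OF D] r by blast
    ultimately show "f' (arc_before (cut_marks ?D' C) (push r)) = f (arc_before (cut_marks D {}) r)"
      and "f' (arc_after (push r)) = f (arc_after r)"
      by (auto simp: f'_def arc_before_def arc_after_def push_def marks inj
          pred_mark_image[OF finite_cmarks[OF D] mono] cut_marks_def[of D])
  qed
  have at_crossing: "f (arc_before (cut_marks D {}) (rising_right D z)) = f (arc_after (rising_left D z))"
    "f (arc_before (cut_marks D {}) (rising_left D z)) = f (arc_after (rising_left D z)) + 1"
    "f (arc_after (rising_right D z)) = f (arc_after (rising_left D z)) + 1"
    if "z \<in> classical D" for z
    using f that unfolding alexander_numbering_def by metis+
  have unpushed: "push r = r" "r \<in> classical_passages D"
    if "z \<in> classical D - {c}" "r \<in> {rising_right D z, rising_left D z}" for z r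
  proof -
    have "z \<in> crossings D"
      using that(1) classical_subset_crossings by auto
    then have "r \<in> passages D z"
      using passages_crossing(2)[OF D] that(2) by auto
    then show "push r = r" "r \<in> classical_passages D"
      using that(1) by (auto simp: push_def \<phi>_def passages_def classical_passages_def)
  qed
  have "alexander_numbering ?D' C f'"
    unfolding alexander_numbering_def
  proof (intro conjI ballI)
    fix z assume "z \<in> classical ?D'"
    then have z: "z \<in> classical D - {c}"
      by (simp add: classical_make_virtual)
    note push = unpushed[OF z, of "rising_right D z"] unpushed[OF z, of "rising_left D z"]
    show "\<exists>i. f' (arc_before (cut_marks ?D' C) (rising_right ?D' z)) = i \<and>
        f' (arc_after (rising_left ?D' z)) = i \<and>
        f' (arc_before (cut_marks ?D' C) (rising_left ?D' z)) = i + 1 \<and>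
        f' (arc_after (rising_right ?D' z)) = i + 1"
      using before[of "rising_right D z"] before[of "rising_left D z"]
        after[of "rising_right D z"] after[of "rising_left D z"] push at_crossing[of z] z
      by simp
  next
    fix x assume "x \<in> C"
    then show "case x of (p, forward) \<Rightarrow>
        f' (arc_after p) = f' (arc_before (cut_marks ?D' C) p) + (if forward then 1 else - 1)"
      using before[OF pq_class(1)] before[OF pq_class(2)] after[OF pq_class(1)] after[OF pq_class(2)]
        at_crossing[OF c] by (auto simp: C_def p_def q_def)
  qed
  \<comment> \<open>Distinct positions give injectivity of \<open>fst\<close> on \<open>C\<close>;
    this has content when both strands at \<open>c\<close> belong to the same component.\<close>
  moreover have "push p \<noteq> push q"
  proof
    assume "push p = push q"
    then have "fst p = fst q" "\<phi> (fst p) (snd p) = \<phi> (fst p) (snd q)"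
      by (auto simp: push_def)
    moreover have "snd p \<in> cmarks D (fst p)" "snd q \<in> cmarks D (fst q)"
      using pq_class classical_passagesD by auto
    ultimately have "p = q"
      using inj_onD[OF inj] by (metis prod_eqI)
    then show False using pq(1) by simp
  qed
  ultimately have "cut_system ?D' C"
    unfolding cut_system_def using push_pq by (auto simp: C_def)
  then show ?thesis
    using that by (simp add: C_def card_insert_if)
qed

section \<open>Indices and the polynomial\<close>

text \<open>
  A directed loop that traverses a semi-arc in both directions collects nothing from it, so
  every cut point contributes at most 1.
\<close>

lemma abs_signed_cut_count_le:
  assumes "finite C"
  shows "\<bar>\<Sum>(a, forward) \<in> L. (if forward then 1 else - 1) * cut_count D C a\<bar> \<le> int (card C)"
\<comment> \<open>For infinite \<open>L\<close> the sum is 0 by convention.\<close>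
proof (cases "finite L")
  case True
  let ?s = "\<lambda>x :: arc \<times> bool. if snd x then 1 else - 1 :: int"
  let ?\<delta> = "\<lambda>c :: cut_point. if snd c then 1 else - 1 :: int"
  let ?arc = "\<lambda>c :: cut_point. arc_before (cmarks D) (fst c)"
  have "cut_count D C a = (\<Sum>c\<in>C. if ?arc c = a then ?\<delta> c else 0)" for a
    unfolding cut_count_def sum.inter_filter[OF assms] by (rule sum.cong) auto
  then have "(\<Sum>(a, forward) \<in> L. (if forward then 1 else - 1) * cut_count D C a)
      = (\<Sum>x\<in>L. \<Sum>c\<in>C. ?s x * (if ?arc c = fst x then ?\<delta> c else 0))"
    by (simp add: case_prod_beta' sum_distrib_left)
  \<comment> \<open>Grouping by cut points instead of arcs reduces the bound to one cut point at a
    time.\<close>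
  also have "\<dots> = (\<Sum>c\<in>C. \<Sum>x\<in>L. ?s x * (if ?arc c = fst x then ?\<delta> c else 0))"
    by (rule sum.swap)
  also have "\<bar>\<dots>\<bar> \<le> (\<Sum>c\<in>C. 1)"
  proof (rule order_trans[OF sum_abs sum_mono])
    fix c
    let ?a = "?arc c"
    \<comment> \<open>Only the two directed versions of the arc carrying \<open>c\<close> can
      contribute, and their contributions have opposite signs.\<close>
    have "(\<Sum>x\<in>L. ?s x * (if ?a = fst x then ?\<delta> c else 0))
        = (\<Sum>x\<in>L \<inter> {(?a, True), (?a, False)}. ?s x * ?\<delta> c)"
      using True by (intro sum.mono_neutral_cong_right) (auto split: if_splits)
    also have "L \<inter> {(?a, True), (?a, False)} = (if (?a, True) \<in> L then {(?a, True)} else {})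
        \<union> (if (?a, False) \<in> L then {(?a, False)} else {})"
      by auto
    finally show "\<bar>\<Sum>x\<in>L. ?s x * (if ?a = fst x then ?\<delta> c else 0)\<bar> \<le> 1"
      by (simp split: if_splits)
  qed
  finally show ?thesis by simp
qed simp

lemma loop_index_le:
  assumes "finite C"
  shows "loop_index D C L \<le> card C div 2"
  unfolding loop_index_def
  by (rule div_le_mono) (use abs_signed_cut_count_le[OF assms, of D L] in simp)

section \<open>Closure properties of the polynomials in powers of \<open>A\<close> and in
  \<open>d_var 1\<close>\<close>

lemma polys_A_d1_iff:
  "p \<in> polys_A_d1 \<longleftrightarrow> (\<forall>x \<in> Poly_Mapping.keys p. Poly_Mapping.keys (snd x) \<subseteq> {1})"
  by (simp add: polys_A_d1_def case_prod_beta)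

lemma polys_A_d1_add: "p \<in> polys_A_d1 \<Longrightarrow> q \<in> polys_A_d1 \<Longrightarrow> p + q \<in> polys_A_d1"
  using Poly_Mapping.keys_add[of p q] unfolding polys_A_d1_iff by blast

lemma polys_A_d1_uminus: "p \<in> polys_A_d1 \<Longrightarrow> - p \<in> polys_A_d1"
  unfolding polys_A_d1_iff by (simp add: in_keys_iff)

lemma polys_A_d1_diff: "p \<in> polys_A_d1 \<Longrightarrow> q \<in> polys_A_d1 \<Longrightarrow> p - q \<in> polys_A_d1"
  using polys_A_d1_add[OF _ polys_A_d1_uminus, of p q] by simp

lemma polys_A_d1_mult:
  assumes "p \<in> polys_A_d1" "q \<in> polys_A_d1"
  shows "p * q \<in> polys_A_d1"
  unfolding polys_A_d1_iff
proof
  fix x assume "x \<in> Poly_Mapping.keys (p * q)"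
  then obtain a b where "x = a + b" "a \<in> Poly_Mapping.keys p" "b \<in> Poly_Mapping.keys q"
    using keys_mult[of p q] by blast
  then have "Poly_Mapping.keys (snd x) \<subseteq> Poly_Mapping.keys (snd a) \<union> Poly_Mapping.keys (snd b)"
    "Poly_Mapping.keys (snd a) \<subseteq> {1}" "Poly_Mapping.keys (snd b) \<subseteq> {1}"
    using assms Poly_Mapping.keys_add[of "snd a" "snd b"] unfolding polys_A_d1_iff by simp_all
  then show "Poly_Mapping.keys (snd x) \<subseteq> {1}"
    by blast
qed

lemma polys_A_d1_one: "1 \<in> polys_A_d1"
  by (simp add: polys_A_d1_iff)

lemma polys_A_d1_power: "p \<in> polys_A_d1 \<Longrightarrow> p ^ n \<in> polys_A_d1"
  by (induction n) (simp_all add: polys_A_d1_one polys_A_d1_mult)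

text \<open>A product over an infinite set is 1 by convention, which also lies in the set.\<close>

lemma polys_A_d1_prod: "(\<And>i. i \<in> I \<Longrightarrow> g i \<in> polys_A_d1) \<Longrightarrow> prod g I \<in> polys_A_d1"
  by (induction I rule: infinite_finite_induct) (simp_all add: polys_A_d1_one polys_A_d1_mult)

lemma polys_A_d1_sum: "(\<And>i. i \<in> I \<Longrightarrow> g i \<in> polys_A_d1) \<Longrightarrow> sum g I \<in> polys_A_d1"
  by (induction I rule: infinite_finite_induct) (simp_all add: polys_A_d1_iff[of 0] polys_A_d1_add)

lemma A_pow_in_polys_A_d1: "A_pow k \<in> polys_A_d1"
  by (simp add: polys_A_d1_iff A_pow_def)

lemma d_var_1_in_polys_A_d1: "d_var 1 \<in> polys_A_d1"
  by (simp add: polys_A_d1_iff d_var_def)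

lemma double_bracket_cut_in_polys_A_d1:
  assumes "finite C" "card C \<le> 2"
  shows "double_bracket_cut D C \<in> polys_A_d1"
proof -
  have index: "loop_index D C L \<le> 1" for L
    using loop_index_le[OF assms(1), of D L] div_le_mono[OF assms(2), of 2] by simp
  have "i \<le> 1" if "num_loops_of_index D C \<sigma> i \<noteq> 0" for \<sigma> i
  proof (rule ccontr)
    assume "\<not> i \<le> 1"
    then have "{L \<in> directed_loops D \<sigma>. loop_index D C L = i} = {}"
      using index by auto
    then show False
      using that by (simp only: num_loops_of_index_def) simp
  qed
  \<comment> \<open>The product starts at 1 and no larger index occurs, so \<open>i = 1\<close> is
    the only possible factor.\<close>
  then have "d_var i ^ num_loops_of_index D C \<sigma> i \<in> polys_A_d1"
    if "1 \<le> i \<and> num_loops_of_index D C \<sigma> i \<noteq> 0" for \<sigma> i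
    using that d_var_1_in_polys_A_d1 polys_A_d1_power by (metis le_antisym)
  then have "(\<Prod>i | 1 \<le> i \<and> num_loops_of_index D C \<sigma> i \<noteq> 0. d_var i ^ num_loops_of_index D C \<sigma> i)
      \<in> polys_A_d1" for \<sigma>
    by (intro polys_A_d1_prod) blast
  then show ?thesis
    unfolding double_bracket_cut_def
    by (intro polys_A_d1_sum polys_A_d1_mult polys_A_d1_power polys_A_d1_diff
        polys_A_d1_uminus A_pow_in_polys_A_d1)
qed

theorem corollary3p3:
  fixes D\<^sub>0 D :: vlink and c :: complex
  assumes "vlink_diagram D\<^sub>0"
    and "almost_classical D\<^sub>0"
    and "c \<in> classical D\<^sub>0"
    and "D = make_virtual D\<^sub>0 c"
  shows "multivariable_poly D \<in> polys_A_d1"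
proof -
  obtain C where C: "cut_system D C" "card C \<le> 2"
    using cut_system_make_virtual[OF assms(1-3)] assms(4) by blast
  have "vlink_diagram D"
    using vlink_diagram_make_virtual[OF assms(1)] assms(4) by simp
  then have "double_bracket D = double_bracket_cut D C"
    using C(1) by (rule double_bracket_eq)
  moreover have "finite C"
    using C(1) by (simp add: cut_system_def)
  ultimately have "double_bracket D \<in> polys_A_d1"
    using double_bracket_cut_in_polys_A_d1 C(2) by simp
  \<comment> \<open>The writhe factor is a power of plus or minus a monomial in \<open>A\<close>
    alone, for either sign of the exponent.\<close>
  moreover have "minus_A3_pow k \<in> polys_A_d1" for k
    by (simp add: minus_A3_pow_def polys_A_d1_power polys_A_d1_uminus A_pow_in_polys_A_d1)
  ultimately show ?thesis
    by (simp add: multivariable_poly_def polys_A_d1_mult)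
qed

end
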